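(* Let $(S,+)$ be an abelian semigroup and $(H,+)$ an abelian group. Let $f:S\to H$ be a map and let $m\in\{2,3,\dots\}$. Consider the claims: (a) There are functions $g_i:S^{m-1}\to H$, $i=1,2,\dots,m$, such that $$f(x_1+x_2+\cdots+x_m)=\sum_{i=1}^{m}g_i(x_1,x_2,\dots,\widehat{x_i},\dots,x_m)$$ for all $x_1,\dots,x_m\in S$. (b) $\Delta_{h_1}\Delta_{h_2}\cdots\Delta_{h_m}f(x_1+x_2+\cdots+x_m)=0$ for all $x_1,\dots,x_m,h_1,\dots,h_m\in S$. (c) $\Delta_{h_1}\Delta_{h_2}\cdots\Delta_{h_m}f(x)=0$ for all $x,h_1,\dots,h_m\in S$. Then (a) implies (b). Furthermore: - If $S+S=S$, then (a) implies (c). - If $S+S=S$ and $0\in S$, then (a), (b) and (c) are equivalent.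
   Context: A semigroup $(S,+)$ is a set with an associative binary operation; it need not have an identity. "$0\in S$" means that $S$ has an identity element $0$ (i.e. $0+a=a+0=a$ for all $a\in S$). $S+S=\{x+y: x,y\in S\}$. For $h\in S$ and $f:S\to H$, the difference operator is $(\Delta_h f)(x)=f(x+h)-f(x)$. In (b), the expression means the function $\Delta_{h_1}\cdots\Delta_{h_m}f$ evaluated at the point $x_1+\cdots+x_m$. The notation $\widehat{x_i}$ means that the variable $x_i$ is omitted, so $g_i$ is a function of the remaining $m-1$ variables. *)

theory Defs
  imports Main
begin

(* The abelian semigroup S is a type 'a :: ab_semigroup_add, which has no distinguished zero.
   An m-tuple over S is a list of length m, numbered from 0. *)

(* x1 + x2 + ... + xm, associated to the left. Without a zero, only nonempty lists are meaningful:
   sum_list is not available for semigroups. *)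
definition semigroup_sum :: "'a::ab_semigroup_add list \<Rightarrow> 'a" where
  "semigroup_sum xs = foldl (+) (hd xs) (tl xs)"

definition omit_nth :: "nat \<Rightarrow> 'a list \<Rightarrow> 'a list" where
  "omit_nth i xs = take i xs @ drop (Suc i) xs"

definition difference_op ::
    "'a::ab_semigroup_add \<Rightarrow> ('a \<Rightarrow> 'b::ab_group_add) \<Rightarrow> 'a \<Rightarrow> 'b" where
  "difference_op h f = (\<lambda>x. f (x + h) - f x)"

(* For hs = [h1, ..., hm]: Delta_h1 (Delta_h2 (... (Delta_hm f))). *)
definition iterated_difference ::
    "'a::ab_semigroup_add list \<Rightarrow> ('a \<Rightarrow> 'b::ab_group_add) \<Rightarrow> 'a \<Rightarrow> 'b" where
  "iterated_difference hs f = foldr difference_op hs f"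

(* Each g i stands for a function on S^(m-1): it is applied only to lists of length m - 1. *)
definition sum_decomposable ::
    "nat \<Rightarrow> ('a::ab_semigroup_add \<Rightarrow> 'b::ab_group_add) \<Rightarrow> bool" where
  "sum_decomposable m f \<longleftrightarrow>
     (\<exists>g :: nat \<Rightarrow> 'a list \<Rightarrow> 'b. \<forall>xs. length xs = m \<longrightarrow>
        f (semigroup_sum xs) = (\<Sum>i<m. g i (omit_nth i xs)))"

definition differences_vanish_at_sums ::
    "nat \<Rightarrow> ('a::ab_semigroup_add \<Rightarrow> 'b::ab_group_add) \<Rightarrow> bool" where
  "differences_vanish_at_sums m f \<longleftrightarrow>
     (\<forall>xs hs. length xs = m \<and> length hs = m \<longrightarrow>
        iterated_difference hs f (semigroup_sum xs) = 0)"

definition differences_vanish ::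
    "nat \<Rightarrow> ('a::ab_semigroup_add \<Rightarrow> 'b::ab_group_add) \<Rightarrow> bool" where
  "differences_vanish m f \<longleftrightarrow>
     (\<forall>x hs. length hs = m \<longrightarrow> iterated_difference hs f x = 0)"

end

theory Submission
  imports Defs
begin

text \<open>
  Two identities between \<open>f\<close> on sums and its iterated differences carry the result.

  Regard \<open>F xs = f (x\<^sub>1 + \<dots> + x\<^sub>m)\<close> as a function of \<open>m\<close> independent variables. Since \<open>S\<close> is
  abelian, increasing any one \<open>x\<^sub>i\<close> by \<open>h\<^sub>i\<close> increases the whole sum by \<open>h\<^sub>i\<close>, so
  \<open>\<Delta>\<^bsub>h\<^sub>1\<^esub> \<dots> \<Delta>\<^bsub>h\<^sub>m\<^esub> f\<close> at \<open>x\<^sub>1 + \<dots> + x\<^sub>m\<close> is the mixed difference of \<open>F\<close> that uses one increment in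
  each variable (\<open>mixed_difference_semigroup_sum\<close>). The mixed difference is additive in \<open>F\<close> and kills
  every function that does not depend on one of the variables
  (\<open>mixed_difference_omit_nth\<close>). Hence (a) implies (b). If \<open>S + S = S\<close>, every element is a sum
  of \<open>m\<close> elements (\<open>semigroup_sum_surj\<close>), and (b) says the same as (c).

  For the way back, write \<open>E\<^sub>h\<close> for the shift by \<open>h\<close>, so that \<open>E\<^sub>h = \<Delta>\<^sub>h + 1\<close>. Turning the shifts in
  \<open>E\<^bsub>h\<^sub>1\<^esub> \<dots> E\<^bsub>h\<^sub>m\<^esub>\<close> into differences one after another gives the telescoping identity
  \<open>E\<^bsub>h\<^sub>1\<^esub> \<dots> E\<^bsub>h\<^sub>m\<^esub> = \<Delta>\<^bsub>h\<^sub>1\<^esub> \<dots> \<Delta>\<^bsub>h\<^sub>m\<^esub> + \<Sum>\<^sub>i E\<^bsub>h\<^sub>1\<^esub> \<dots> E\<^bsub>h\<^sub>i\<^sub>-\<^sub>1\<^esub> \<Delta>\<^bsub>h\<^sub>i\<^sub>+\<^sub>1\<^esub> \<dots> \<Delta>\<^bsub>h\<^sub>m\<^esub>\<close>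
  (\<open>shift_eq_difference_plus_sum\<close>), in which the \<open>i\<close>th summand does not contain \<open>h\<^sub>i\<close>. Applied to
  \<open>f\<close> and evaluated at \<open>0\<close>, it is a decomposition as in (a) as soon as (c) holds.
\<close>

fun mixed_difference ::
    "'a::plus list \<Rightarrow> 'a list \<Rightarrow> ('a list \<Rightarrow> 'b::ab_group_add) \<Rightarrow> 'b" where
  "mixed_difference (h # hs) (x # xs) F =
     mixed_difference hs xs (\<lambda>ys. F ((x + h) # ys)) - mixed_difference hs xs (\<lambda>ys. F (x # ys))"
| "mixed_difference hs xs F = F []"

lemma mixed_difference_cong:
  assumes "length hs = length xs" and "\<And>ys. length ys = length xs \<Longrightarrow> F ys = G ys"
  shows "mixed_difference hs xs F = mixed_difference hs xs G"
  using assms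
proof (induction hs xs arbitrary: F G rule: list_induct2)
  case Nil
  then show ?case by simp
next
  case (Cons h hs x xs)
  have "mixed_difference hs xs (\<lambda>ys. F (y # ys)) = mixed_difference hs xs (\<lambda>ys. G (y # ys))" for y
    by (rule Cons.IH) (simp add: Cons.prems)
  then show ?case by simp
qed

lemma mixed_difference_add:
  assumes "length hs = length xs"
  shows "mixed_difference hs xs (\<lambda>ys. F ys + G ys) = mixed_difference hs xs F + mixed_difference hs xs G"
  using assms by (induction hs xs arbitrary: F G rule: list_induct2) auto

lemma mixed_difference_zero:
  assumes "length hs = length xs"
  shows "mixed_difference hs xs (\<lambda>ys. 0) = 0"
  using assms by (induction hs xs rule: list_induct2) auto

lemma mixed_difference_sum:
  assumes "length hs = length xs"
  shows "mixed_difference hs xs (\<lambda>ys. \<Sum>i\<in>A. F i ys) = (\<Sum>i\<in>A. mixed_difference hs xs (F i))"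
  using assms
  by (induction A rule: infinite_finite_induct)
     (simp_all add: mixed_difference_zero mixed_difference_add)

text \<open>A function that ignores the \<open>i\<close>th variable takes the same values before and after an
  increment of that variable, so the difference in that direction already vanishes.\<close>
lemma mixed_difference_omit_nth:
  assumes "length hs = length xs" and "i < length xs"
  shows "mixed_difference hs xs (\<lambda>ys. g (omit_nth i ys)) = 0"
  using assms
proof (induction hs xs arbitrary: i g rule: list_induct2)
  case Nil
  then show ?case by simp
next
  case (Cons h hs x xs)
  show ?case
  proof (cases i)
    case 0
    then show ?thesis by (simp add: omit_nth_def)
  next
    case (Suc j)
    have "mixed_difference hs xs (\<lambda>ys. g (omit_nth i (y # ys))) = 0" for y
      using Cons.IH[of j "\<lambda>zs. g (y # zs)"] Cons.prems Suc by (simp add: omit_nth_def)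
    then show ?thesis by simp
  qed
qed

lemma iterated_difference_Nil: "iterated_difference [] f x = f x"
  by (simp add: iterated_difference_def)

lemma iterated_difference_Cons:
  "iterated_difference (h # hs) f x = iterated_difference hs f (x + h) - iterated_difference hs f x"
  by (simp add: iterated_difference_def difference_op_def)

lemma foldl_plus_start: "foldl (+) (a + h) xs = foldl (+) a xs + (h::'a::ab_semigroup_add)"
proof (induction xs arbitrary: a)
  case (Cons x xs)
  have "a + h + x = a + x + h" by (simp add: ac_simps)
  then show ?case using Cons.IH[of "a + x"] by simp
qed simp

text \<open>The sum starts from an arbitrary \<open>a\<close> because peeling off the first variable in the induction
  leaves a sum whose starting value contains that variable.\<close>
lemma mixed_difference_foldl_plus:
  fixes f :: "'a::ab_semigroup_add \<Rightarrow> 'b::ab_group_add"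
  assumes "length hs = length xs"
  shows "mixed_difference hs xs (\<lambda>ys. f (foldl (+) a ys)) = iterated_difference hs f (foldl (+) a xs)"
  using assms
proof (induction hs xs arbitrary: a rule: list_induct2)
  case Nil
  then show ?case by (simp add: iterated_difference_Nil)
next
  case (Cons h hs x xs)
  then show ?case
    by (simp add: iterated_difference_Cons flip: foldl_plus_start add.assoc)
qed

lemma semigroup_sum_Cons: "semigroup_sum (x # xs) = foldl (+) x xs"
  by (simp add: semigroup_sum_def)

lemma mixed_difference_semigroup_sum:
  fixes f :: "'a::ab_semigroup_add \<Rightarrow> 'b::ab_group_add"
  assumes "length hs = length xs" and "xs \<noteq> []"
  shows "mixed_difference hs xs (\<lambda>ys. f (semigroup_sum ys)) =
    iterated_difference hs f (semigroup_sum xs)"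
proof -
  obtain x xs' where xs: "xs = x # xs'" using assms(2) by (cases xs) auto
  then obtain h hs' where hs: "hs = h # hs'" using assms(1) by (cases hs) auto
  show ?thesis using assms(1) unfolding xs hs
    by (simp add: semigroup_sum_Cons iterated_difference_Cons mixed_difference_foldl_plus
        flip: foldl_plus_start)
qed

lemma sum_decomposable_imp_differences_vanish_at_sums:
  assumes "m > 0" and "sum_decomposable m f"
  shows "differences_vanish_at_sums m f"
  unfolding differences_vanish_at_sums_def
proof (intro allI impI, elim conjE)
  fix xs hs :: "'a list"
  assume len: "length xs = m" "length hs = m"
  obtain g where g: "\<And>ys. length ys = m \<Longrightarrow> f (semigroup_sum ys) = (\<Sum>i<m. g i (omit_nth i ys))"
    using assms(2) unfolding sum_decomposable_def by blast
  have "iterated_difference hs f (semigroup_sum xs) =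
      mixed_difference hs xs (\<lambda>ys. f (semigroup_sum ys))"
    using len assms(1) by (intro mixed_difference_semigroup_sum[symmetric]) auto
  also have "\<dots> = mixed_difference hs xs (\<lambda>ys. \<Sum>i<m. g i (omit_nth i ys))"
    by (rule mixed_difference_cong) (simp_all add: len g)
  also have "\<dots> = (\<Sum>i<m. mixed_difference hs xs (\<lambda>ys. g i (omit_nth i ys)))"
    by (rule mixed_difference_sum) (simp add: len)
  also have "\<dots> = 0"
    by (intro sum.neutral ballI mixed_difference_omit_nth) (simp_all add: len)
  finally show "iterated_difference hs f (semigroup_sum xs) = 0" .
qed

text \<open>A representation as a sum of \<open>m\<close> elements is lengthened by splitting its first term in two.\<close>
lemma semigroup_sum_surj:
  fixes x :: "'a::ab_semigroup_add"
  assumes "{y + z | y z. True} = (UNIV :: 'a set)" and "m > 0"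
  shows "\<exists>xs. length xs = m \<and> semigroup_sum xs = x"
proof -
  have "\<exists>a xs. length xs = n \<and> foldl (+) a xs = x" for n
  proof (induction n)
    case 0
    show ?case by simp
  next
    case (Suc n)
    then obtain a xs where xs: "length xs = n" "foldl (+) a xs = x" by blast
    obtain b c where "a = b + c" using assms(1) by blast
    with xs have "length (c # xs) = Suc n \<and> foldl (+) b (c # xs) = x" by simp
    then show ?case by blast
  qed
  then obtain a xs where "length xs = m - 1" "foldl (+) a xs = x" by blast
  then have "length (a # xs) = m \<and> semigroup_sum (a # xs) = x"
    using assms(2) by (simp add: semigroup_sum_Cons)
  then show ?thesis by blast
qed

lemma differences_vanish_at_sums_iff_differences_vanish:
  fixes f :: "'a::ab_semigroup_add \<Rightarrow> 'b::ab_group_add"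
  assumes "{y + z | y z. True} = (UNIV :: 'a set)" and "m > 0"
  shows "differences_vanish_at_sums m f \<longleftrightarrow> differences_vanish m f"
  unfolding differences_vanish_at_sums_def differences_vanish_def
  using semigroup_sum_surj[OF assms] by metis

text \<open>The induction step is the single exchange \<open>E\<^sub>h = \<Delta>\<^sub>h + 1\<close>, applied to \<open>\<Delta>\<^bsub>h\<^sub>2\<^esub> \<dots> \<Delta>\<^bsub>h\<^sub>m\<^esub> f\<close> at \<open>x\<close>: the
  term from \<open>1\<close> is the summand for the index \<open>0\<close>, and the remaining summands are those for the list
  without its head, shifted by one.\<close>
lemma shift_eq_difference_plus_sum:
  fixes f :: "'a::ab_semigroup_add \<Rightarrow> 'b::ab_group_add"
  shows "f (foldl (+) x hs) = iterated_difference hs f x +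
    (\<Sum>i<length hs. iterated_difference (drop (Suc i) hs) f (foldl (+) x (take i hs)))"
proof (induction hs arbitrary: x)
  case Nil
  show ?case by (simp add: iterated_difference_Nil)
next
  case (Cons h hs)
  show ?case
    using Cons.IH[of "x + h"]
    by (simp add: sum.lessThan_Suc_shift iterated_difference_Cons del: sum.lessThan_Suc)
qed

lemma differences_vanish_imp_sum_decomposable:
  fixes f :: "'a::ab_semigroup_add \<Rightarrow> 'b::ab_group_add"
  assumes zero: "\<And>a::'a. z + a = a" and "m > 0" and "differences_vanish m f"
  shows "sum_decomposable m f"
proof -
  (* In a list from which entry i (counted from 0) has been omitted, the first i entries are those
     that preceded it and the rest are those that followed it. *)
  define g :: "nat \<Rightarrow> 'a list \<Rightarrow> 'b"
    where "g i ys = iterated_difference (drop i ys) f (foldl (+) z (take i ys))" for i ys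
  have "f (semigroup_sum xs) = (\<Sum>i<m. g i (omit_nth i xs))" if len: "length xs = m" for xs
  proof -
    have "semigroup_sum xs = foldl (+) z xs"
      using len \<open>m > 0\<close> by (cases xs) (simp_all add: semigroup_sum_Cons zero)
    then have "f (semigroup_sum xs) =
        (\<Sum>i<m. iterated_difference (drop (Suc i) xs) f (foldl (+) z (take i xs)))"
      using shift_eq_difference_plus_sum[of f z xs] assms(3) len
      by (simp add: differences_vanish_def)
    also have "\<dots> = (\<Sum>i<m. g i (omit_nth i xs))"
      by (intro sum.cong refl) (simp add: g_def omit_nth_def len)
    finally show ?thesis .
  qed
  then show ?thesis unfolding sum_decomposable_def by blast
qed

theorem theorem2:
  fixes f :: "'a::ab_semigroup_add \<Rightarrow> 'b::ab_group_add" and m :: nat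
  assumes "m \<ge> 2"
  shows "(sum_decomposable m f \<longrightarrow> differences_vanish_at_sums m f) \<and>
    ({x + y | x y. True} = (UNIV :: 'a set) \<longrightarrow>
       sum_decomposable m f \<longrightarrow> differences_vanish m f) \<and>
    ({x + y | x y. True} = (UNIV :: 'a set) \<and> (\<exists>z::'a. \<forall>a. z + a = a \<and> a + z = a) \<longrightarrow>
       (sum_decomposable m f \<longleftrightarrow> differences_vanish_at_sums m f) \<and>
       (differences_vanish_at_sums m f \<longleftrightarrow> differences_vanish m f))"
proof -
  have pos: "m > 0" using assms by simp
  note ab = sum_decomposable_imp_differences_vanish_at_sums[OF pos, of f]
  have bc: "differences_vanish_at_sums m f \<longleftrightarrow> differences_vanish m f"
    if "{x + y | x y. True} = (UNIV :: 'a set)"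
    using differences_vanish_at_sums_iff_differences_vanish[OF that pos] .
  have ca: "sum_decomposable m f"
    if "\<exists>z::'a. \<forall>a. z + a = a \<and> a + z = a" and "differences_vanish m f"
    using that differences_vanish_imp_sum_decomposable[OF _ pos] by blast
  show ?thesis using ab bc ca by blast
qed

end
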